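(* Let $f:\{-1,1\}^n\to\{-1,1\}$ and $\delta>0$. If $\mathrm{disc}(f\circ\mathsf{XOR})<\delta$, then $\mathrm{disc}(f\circ\mathsf{PM})\le\sqrt{4\delta n}$.
   Context: Identify $\{0,1\}$ with $\{1,-1\}$ ($0\leftrightarrow1$, $1\leftrightarrow-1$). $(f\circ\mathsf{XOR})(x,y)=f(x\oplus y)$ with Alice holding $x\in\{0,1\}^n$ and Bob $y\in\{0,1\}^n$. Pattern matrix composition: Alice gets bits $x_{i,1},x_{i,2}$ ($i\in[n]$), Bob gets bits $z_i,w_i$ ($i\in[n]$); $\mathsf{PM}(x_{i,1},x_{i,2},z_i,w_i)=x_{i,z_i}\oplus w_i$ (Bob's bit $z_i$ selects one of Alice's two bits), and $(f\circ\mathsf{PM})$ is $f$ applied to the $n$ resulting bits. For $F:X\times Y\to\{-1,1\}$ and a distribution $\lambda$ on $X\times Y$, $\mathrm{disc}_\lambda(F)=\max_{S\subseteq X,T\subseteq Y}\big|\sum_{(x,y)\in S\times T}F(x,y)\lambda(x,y)\big|$, and $\mathrm{disc}(F)=\min_\lambda\mathrm{disc}_\lambda(F)$. *)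

theory Defs
  imports "HOL-Probability.Probability"
begin

text \<open>Bits are of type \<^typ>\<open>bool\<close>, where \<^const>\<open>False\<close> stands for bit $0$ (sign $1$) and
  \<^const>\<open>True\<close> for bit $1$ (sign $-1$). The index set $[n]$ is a finite type \<open>'n\<close> with
  \<open>n = CARD('n)\<close>.\<close>

definition XOR :: "bool \<Rightarrow> bool \<Rightarrow> bool" where
  "XOR a b \<longleftrightarrow> a \<noteq> b"

text \<open>Alice holds the pair \<open>(x\<^sub>1, x\<^sub>2)\<close>, Bob the pair \<open>(z, w)\<close>; the values $0, 1$ of \<open>z\<close> select
  the first and the second bit of Alice respectively.\<close>

definition PM :: "bool \<times> bool \<Rightarrow> bool \<times> bool \<Rightarrow> bool" where
  "PM = (\<lambda>(x1, x2) (z, w). XOR (if z then x2 else x1) w)"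

definition gadget_comp ::
    "(('n \<Rightarrow> bool) \<Rightarrow> real) \<Rightarrow> ('a \<Rightarrow> 'b \<Rightarrow> bool) \<Rightarrow> ('n \<Rightarrow> 'a) \<Rightarrow> ('n \<Rightarrow> 'b) \<Rightarrow> real" where
  "gadget_comp f g x y = f (\<lambda>i. g (x i) (y i))"

definition disc_wrt :: "('a::finite \<times> 'b::finite) pmf \<Rightarrow> ('a \<Rightarrow> 'b \<Rightarrow> real) \<Rightarrow> real" where
  "disc_wrt \<mu> F =
     Max {\<bar>\<Sum>(x, y)\<in>S \<times> T. F x y * pmf \<mu> (x, y)\<bar> | S T. True}"

text \<open>The set of distributions on a finite set is compact and \<open>disc_wrt\<close> is continuous in the
  distribution, so the infimum below is a minimum.\<close>

definition disc :: "('a::finite \<Rightarrow> 'b::finite \<Rightarrow> real) \<Rightarrow> real" where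
  "disc F = (INF \<mu>. disc_wrt \<mu> F)"

end

(* Fixing all of Bob's selector bits to 0 embeds f o XOR as a submatrix of f o PM, so a
   distribution for the former pushes forward to one for the latter and
   d = disc (f o PM) <= disc (f o XOR) < \<delta>. Since also 0 <= d <= 1, d^2 <= \<delta> <= 4 \<delta> n. *)
theory Submission imports Defs begin

text \<open>Finiteness is what makes the \<open>Max\<close> in \<open>disc_wrt\<close> meaningful:
  there are only finitely many rectangles over finite types.\<close>

lemma finite_disc_set:
  "finite {\<bar>\<Sum>(x, y)\<in>S \<times> T. F x y * pmf \<mu> (x, y)\<bar>
     | (S::'a::finite set) (T::'b::finite set). True}"
proof -
  have "{\<bar>\<Sum>(x, y)\<in>S \<times> T. F x y * pmf \<mu> (x, y)\<bar> | (S::'a set) (T::'b set). True}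
    = (\<lambda>(S, T). \<bar>\<Sum>(x, y)\<in>S \<times> T. F x y * pmf \<mu> (x, y)\<bar>) ` UNIV"
    by auto
  then show ?thesis by (simp only: finite_imageI finite)
qed

lemma disc_wrt_ge:
  "\<bar>\<Sum>(x, y)\<in>S \<times> T. F x y * pmf \<mu> (x, y)\<bar> \<le> disc_wrt \<mu> F"
  unfolding disc_wrt_def by (rule Max_ge[OF finite_disc_set]) blast

lemma disc_wrt_leI:
  assumes "\<And>S T. \<bar>\<Sum>(x, y)\<in>S \<times> T. F x y * pmf \<mu> (x, y)\<bar> \<le> c"
  shows "disc_wrt \<mu> F \<le> c"
  unfolding disc_wrt_def using assms by (subst Max_le_iff[OF finite_disc_set]) auto

lemma disc_wrt_nonneg: "0 \<le> disc_wrt \<mu> F"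
  \<comment> \<open>The empty rectangle contributes the value 0 to the maximum.\<close>
  using disc_wrt_ge[where S = "{}" and T = "{}" and F = F and \<mu> = \<mu>] by simp

text \<open>The reals are only conditionally complete, so an upper bound on \<open>disc\<close> by a
  single distribution needs this bound first.\<close>

lemma bdd_below_disc_wrt: "bdd_below (range (\<lambda>\<mu>. disc_wrt \<mu> F))"
  by (rule bdd_belowI2[of _ 0]) (simp add: disc_wrt_nonneg)

lemma disc_le_disc_wrt: "disc F \<le> disc_wrt \<mu> F"
  unfolding disc_def by (rule cINF_lower[OF bdd_below_disc_wrt]) simp

lemma disc_nonneg: "0 \<le> disc F"
  unfolding disc_def by (rule cINF_greatest) (simp_all add: disc_wrt_nonneg)

lemma disc_le_1:
  fixes F :: "'a::finite \<Rightarrow> 'b::finite \<Rightarrow> real"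
  assumes "\<And>x y. \<bar>F x y\<bar> \<le> 1"
  shows "disc F \<le> 1"
proof -
  \<comment> \<open>Any single distribution bounds the infimum from above. For it, each rectangle
    sum is at most the probability of the rectangle.\<close>
  fix \<mu> :: "('a \<times> 'b) pmf"
  have "disc_wrt \<mu> F \<le> 1"
  proof (rule disc_wrt_leI)
    fix S :: "'a set" and T :: "'b set"
    have "\<bar>\<Sum>(x, y)\<in>S \<times> T. F x y * pmf \<mu> (x, y)\<bar> \<le> (\<Sum>p\<in>S \<times> T. pmf \<mu> p)"
      by (intro order.trans[OF sum_abs] sum_mono)
        (auto simp: abs_mult intro!: mult_left_le_one_le assms)
    also have "\<dots> = measure_pmf.prob \<mu> (S \<times> T)"
      by (simp add: measure_measure_pmf_finite)
    also have "\<dots> \<le> 1" by simp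
    finally show "\<bar>\<Sum>(x, y)\<in>S \<times> T. F x y * pmf \<mu> (x, y)\<bar> \<le> 1" .
  qed
  then show ?thesis using disc_le_disc_wrt[of F \<mu>] by linarith
qed

text \<open>Point masses of a pushforward are sums over fibres, whereas expectations obey a change
  of variables; this form makes \<open>map_pmf\<close> easy to handle.\<close>

lemma rectangle_sum_eq_expectation:
  fixes F :: "'a::finite \<Rightarrow> 'b::finite \<Rightarrow> real"
  shows "(\<Sum>(x, y)\<in>S \<times> T. F x y * pmf \<mu> (x, y)) =
    measure_pmf.expectation \<mu> (\<lambda>(x, y). F x y * indicator (S \<times> T) (x, y))"
  by (subst integral_measure_pmf[of UNIV])
    (auto simp: indicator_def intro!: sum.mono_neutral_cong_left split: if_splits)

text \<open>Since \<open>g\<close> and \<open>h\<close> act on the two sides separately, the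
  preimage of a rectangle is again a rectangle, with the same weighted sum. Only rectangles that are
  such preimages arise, hence an inequality.\<close>

lemma disc_wrt_map_pmf_le:
  fixes g :: "'c::finite \<Rightarrow> 'a::finite" and h :: "'d::finite \<Rightarrow> 'b::finite"
  shows "disc_wrt (map_pmf (map_prod g h) \<mu>) F \<le> disc_wrt \<mu> (\<lambda>x y. F (g x) (h y))"
proof (rule disc_wrt_leI)
  fix S :: "'a set" and T :: "'b set"
  have "(\<Sum>(x, y)\<in>S \<times> T. F x y * pmf (map_pmf (map_prod g h) \<mu>) (x, y)) =
    (\<Sum>(x, y)\<in>(g -` S) \<times> (h -` T). F (g x) (h y) * pmf \<mu> (x, y))"
    unfolding rectangle_sum_eq_expectation
    by (auto simp: indicator_def intro!: Bochner_Integration.integral_cong)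
  then show "\<bar>\<Sum>(x, y)\<in>S \<times> T. F x y * pmf (map_pmf (map_prod g h) \<mu>) (x, y)\<bar>
    \<le> disc_wrt \<mu> (\<lambda>x y. F (g x) (h y))"
    using
      disc_wrt_ge[where S = "g -` S" and T = "h -` T" and \<mu> = \<mu> and F = "\<lambda>x y. F (g x) (h y)"] by simp
qed

text \<open>Selecting rows by \<open>g\<close> and columns by \<open>h\<close> cannot lower the
  discrepancy: every distribution on the selected matrix pushes forward to a competitor for
  \<open>F\<close>.\<close>

lemma disc_le_disc_restrict:
  fixes g :: "'c::finite \<Rightarrow> 'a::finite" and h :: "'d::finite \<Rightarrow> 'b::finite"
  shows "disc F \<le> disc (\<lambda>x y. F (g x) (h y))"
proof -
  have "disc F \<le> disc_wrt \<mu> (\<lambda>x y. F (g x) (h y))" for \<mu>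
    using disc_le_disc_wrt disc_wrt_map_pmf_le by (rule order.trans)
  then show ?thesis
    unfolding disc_def[of "\<lambda>x y. F (g x) (h y)"] by (intro cINF_greatest) simp_all
qed

lemma disc_PM_le_disc_XOR:
  fixes f :: "('n::finite \<Rightarrow> bool) \<Rightarrow> real"
  shows "disc (gadget_comp f PM) \<le> disc (gadget_comp f XOR)"
proof -
  \<comment> \<open>Alice's input becomes her first bit and Bob's becomes his mask bit. Her second
    bit is filler, never read under the selector \<open>False\<close>.\<close>
  have "gadget_comp f XOR =
      (\<lambda>x y. gadget_comp f PM (\<lambda>i. (x i, False)) (\<lambda>i. (False, y i)))"
    by (simp add: gadget_comp_def PM_def fun_eq_iff)
  then show ?thesis
    using disc_le_disc_restrict[of "gadget_comp f PM"
        "\<lambda>x i. (x i, False)" "\<lambda>y i. (False, y i)"] by simp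
qed

theorem mainTheorem12:
  fixes f :: "('n::finite \<Rightarrow> bool) \<Rightarrow> real" and \<delta> :: real
  assumes "\<And>x. f x \<in> {-1, 1}"
    and "\<delta> > 0"
    and "disc (gadget_comp f XOR) < \<delta>"
  shows "disc (gadget_comp f PM) \<le> sqrt (4 * \<delta> * real CARD('n))"
proof (rule real_le_rsqrt)
  let ?d = "disc (gadget_comp f PM)"
  have "\<bar>f x\<bar> \<le> 1" for x using assms(1)[of x] by auto
  then have "?d \<le> 1" by (intro disc_le_1) (simp add: gadget_comp_def)
  then have "?d\<^sup>2 \<le> ?d"
    by (simp add: power2_eq_square mult_left_le disc_nonneg)
  also have "\<dots> \<le> \<delta>" using disc_PM_le_disc_XOR[of f] assms(3) by linarith
  also have "\<dots> \<le> 4 * \<delta> * real CARD('n)"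
  proof -
    \<comment> \<open>Types are nonempty, so the index set has at least one element.\<close>
    have "1 \<le> 4 * real CARD('n)" using zero_less_card_finite[where 'a='n] by linarith
    from mult_left_mono[OF this, of \<delta>] show ?thesis using assms(2) by (simp add: mult_ac)
  qed
  finally show "?d\<^sup>2 \<le> 4 * \<delta> * real CARD('n)" .
qed

end
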